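(* Let $X$ be a set with at least two elements, $\Gamma$ a nonempty set, $\varphi:\Gamma\to\Gamma$ an arbitrary map, and let $\sigma_\varphi:X^\Gamma\to X^\Gamma$, $\sigma_\varphi((x_\alpha)_{\alpha\in\Gamma})=(x_{\varphi(\alpha)})_{\alpha\in\Gamma}$, be the generalized shift. Then $$\mathrm{ent}_{\rm set}(\sigma_\varphi)=\begin{cases}0 & \text{if }\varphi\text{ is quasi-periodic},\\ \infty & \text{otherwise}.\end{cases}$$
   Context: A self-map $g:A\to A$ is quasi-periodic if there exist $n>m\geq 1$ with $g^n=g^m$. For a self-map $g:A\to A$ and a finite subset $D\subseteq A$ put $\mathrm{ent}_{\rm set}(g,D)=\lim_{n\to\infty}\frac{|D\cup g(D)\cup\cdots\cup g^{n-1}(D)|}{n}$ (the limit exists), and the set-theoretical entropy of $g$ is $\mathrm{ent}_{\rm set}(g)=\sup\{\mathrm{ent}_{\rm set}(g,D): D\text{ a finite subset of }A\}\in[0,\infty]$. It is known that $\mathrm{ent}_{\rm set}(g)$ equals $\sup(\{0\}\cup\{k\geq1:$ there exist $k$ pairwise disjoint infinite orbits of $g\})$, where the orbit of $a\in A$ is $\{g^n(a):n\geq0\}$. *)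

theory Defs
  imports Complex_Main "HOL-Library.FuncSet" "HOL-Library.Extended_Real"
begin

definition quasi_periodic_on :: "'a set \<Rightarrow> ('a \<Rightarrow> 'a) \<Rightarrow> bool" where
  "quasi_periodic_on A g \<longleftrightarrow>
     (\<exists>n m. n > m \<and> m \<ge> (1::nat) \<and> (\<forall>a\<in>A. (g ^^ n) a = (g ^^ m) a))"

text \<open>The limit below always exists; see \<open>LIMSEQ_ent_set_at\<close>.\<close>

definition ent_set_at :: "('a \<Rightarrow> 'a) \<Rightarrow> 'a set \<Rightarrow> real" where
  "ent_set_at g D = lim (\<lambda>n. real (card (\<Union>k<n. (g ^^ k) ` D)) / real n)"

text \<open>The first argument is the set on which \<open>g\<close> is regarded as a self-map.\<close>

definition ent_set :: "'a set \<Rightarrow> ('a \<Rightarrow> 'a) \<Rightarrow> ereal" where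
  "ent_set A g = (SUP D\<in>{D. finite D \<and> D \<subseteq> A}. ereal (ent_set_at g D))"

text \<open>
  The product \<open>X\<^sup>\<Gamma>\<close> is rendered as \<open>\<Gamma> \<rightarrow>\<^sub>E X\<close>, whose elements take the fixed value
  \<open>undefined\<close> outside \<open>\<Gamma>\<close>; this is why the shifted family is restricted to \<open>\<Gamma>\<close>.
\<close>

definition gen_shift :: "'i set \<Rightarrow> ('i \<Rightarrow> 'i) \<Rightarrow> ('i \<Rightarrow> 'x) \<Rightarrow> ('i \<Rightarrow> 'x)" where
  "gen_shift \<Gamma> \<phi> x = (\<lambda>\<alpha>\<in>\<Gamma>. x (\<phi> \<alpha>))"

lemma gen_shift_in_PiE:
  assumes "\<phi> \<in> \<Gamma> \<rightarrow> \<Gamma>" "x \<in> \<Gamma> \<rightarrow>\<^sub>E X"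
  shows "gen_shift \<Gamma> \<phi> x \<in> \<Gamma> \<rightarrow>\<^sub>E X"
  using assms unfolding gen_shift_def by (auto simp: PiE_iff Pi_iff)

lemma convergent_card_iterates:
  fixes g :: "'a \<Rightarrow> 'a"
  assumes D: "finite D"
  shows "convergent (\<lambda>n. real (card (\<Union>k<n. (g ^^ k) ` D)) / real n)"
proof -
  define S where "S n = (\<Union>k<n. (g ^^ k) ` D)" for n
  define a where "a n = card (S (Suc n) - S n)" for n
  have fin: "finite (S n)" for n using D by (simp add: S_def)
  have Suc: "S (Suc n) = S n \<union> (g ^^ n) ` D" for n
    by (auto simp: S_def lessThan_Suc)
  have img: "g ` S n \<subseteq> S (Suc n)" for n
  proof
    fix y assume "y \<in> g ` S n"
    then obtain k d where "k < n" "d \<in> D" "y = (g ^^ Suc k) d"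
      by (auto simp: S_def)
    then show "y \<in> S (Suc n)"
      unfolding S_def by (intro UN_I[of "Suc k"]) auto
  qed
  have dec: "a (Suc n) \<le> a n" for n
  proof -
    have "S (Suc (Suc n)) - S (Suc n) \<subseteq> g ` (S (Suc n) - S n)"
    proof
      fix y assume y: "y \<in> S (Suc (Suc n)) - S (Suc n)"
      then obtain d where d: "d \<in> D" "y = g ((g ^^ n) d)"
        using Suc[of "Suc n"] by auto
      moreover have "(g ^^ n) d \<in> S (Suc n)" using d Suc[of n] by auto
      moreover have "(g ^^ n) d \<notin> S n" using y d img[of n] by auto
      ultimately show "y \<in> g ` (S (Suc n) - S n)" by blast
    qed
    then show ?thesis
      unfolding a_def using fin by (meson card_image_le card_mono finite_Diff finite_imageI le_trans)
  qed
  have anti: "a n \<le> a m" if "m \<le> n" for m n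
    using lift_Suc_antimono_le[of a, OF dec that] .
  obtain N where N: "\<And>n. a N \<le> a n"
    using ex_has_least_nat[of "\<lambda>_. True" 0 a] by auto
  have const: "a n = a N" if "N \<le> n" for n
    using anti[OF that] N[of n] by simp
  have step: "card (S (Suc n)) = card (S n) + a n" for n
  proof -
    have "S (Suc n) = S n \<union> (S (Suc n) - S n)" using Suc[of n] by auto
    then show ?thesis unfolding a_def using fin
      by (metis Diff_disjoint card_Un_disjoint finite_Diff)
  qed
  have card: "card (S (N + j)) = card (S N) + j * a N" for j
    by (induction j) (simp_all add: step const[OF le_add1])
  have eq: "real (card (S n)) / real n
      = (real (card (S N)) - real N * real (a N)) / real n + real (a N)" if "n \<ge> Suc N" for n
  proof -
    have "real (card (S n)) = real (card (S N)) + (real n - real N) * real (a N)"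
      using card[of "n - N"] that by (simp add: of_nat_diff)
    then show ?thesis using that by (simp add: field_simps)
  qed
  have "(\<lambda>n. (real (card (S N)) - real N * real (a N)) / real n + real (a N)) \<longlonglongrightarrow> 0 + real (a N)"
    by (intro tendsto_add lim_const_over_n tendsto_const)
  then have "(\<lambda>n. real (card (S n)) / real n) \<longlonglongrightarrow> 0 + real (a N)"
    by (rule Lim_transform_eventually) (use eq in \<open>force simp: eventually_sequentially intro: exI[of _ "Suc N"]\<close>)
  then show ?thesis unfolding S_def convergent_def by blast
qed

lemma LIMSEQ_ent_set_at:
  "finite D \<Longrightarrow> (\<lambda>n. real (card (\<Union>k<n. (g ^^ k) ` D)) / real n) \<longlonglongrightarrow> ent_set_at g D"
  using convergent_card_iterates[of D g] by (simp add: ent_set_at_def convergent_LIMSEQ_iff)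

end

theory Submission
  imports Defs "HOL-Library.Countable_Set"
begin

text \<open>
  If \<open>\<phi>\<close> is quasi-periodic, a relation \<open>\<phi>\<^sup>n = \<phi>\<^sup>m\<close> passes to the generalized shift
  \<open>\<sigma>\<close>, because \<open>\<sigma>\<^sup>k x = x \<circ> \<phi>\<^sup>k\<close> on \<open>\<Gamma>\<close>. Then all trajectories of a finite set stay in a fixed
  finite set and the entropy vanishes (\<open>ent_set_at_eq_0\<close>).

  If \<open>\<phi>\<close> is not quasi-periodic, there is even an infinite sequence of points \<open>x\<^sub>0, x\<^sub>1, \<dots>\<close> whose
  orbits are infinite and pairwise disjoint, that is, \<open>(j, n) \<mapsto> \<sigma>\<^sup>n x\<^sub>j\<close> is injective; the
  first \<open>K\<close> of them then have entropy \<open>K\<close> (\<open>ent_set_at_disjoint_orbits\<close>). Rather than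
  distinguishing whether \<open>\<phi>\<close> has an infinite orbit, unbounded periods or unbounded pre-periods,
  the points are found by a genericity argument. Only two letters of \<open>X\<close> are used, so the
  sequence is a single \<open>2\<close>-colouring of \<open>\<nat> \<times> \<Gamma>\<close>, and injectivity amounts to countably many
  requirements, one for each pair \<open>(j, n) \<noteq> (l, m)\<close>: some \<open>a \<in> \<Gamma>\<close> must give the points
  \<open>(j, \<phi>\<^sup>n a)\<close> and \<open>(l, \<phi>\<^sup>m a)\<close> different colours. These are met one after the other, each
  by colouring finitely many points (\<open>exists_separating_colouring\<close>). This never gets stuck as long
  as, for \<open>m \<le> n\<close> and any finite \<open>F \<subseteq> \<Gamma>\<close>, some \<open>a\<close> has \<open>\<phi>\<^sup>m a \<notin> F\<close> and
  (if \<open>m < n\<close>) \<open>\<phi>\<^sup>n a \<noteq> \<phi>\<^sup>m a\<close>; by pigeonhole, the failure of this would make \<open>\<phi>\<close>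
  quasi-periodic (\<open>quasi_periodic_on_if_finite_exceptions\<close>).
\<close>

section \<open>Iterates and quasi-periodicity\<close>

lemma funpow_funpow: "(g ^^ m) ((g ^^ n) a) = (g ^^ (m + n)) a"
  by (simp only: funpow_add comp_apply)

lemma funpow_in: "g \<in> A \<rightarrow> A \<Longrightarrow> a \<in> A \<Longrightarrow> (g ^^ k) a \<in> A"
  by (induction k) auto

text \<open>From \<open>g\<^sup>i b\<close> on, \<open>j - i\<close> is a period, and it divides \<open>N!\<close>. The point of the conclusion is that
  its exponents depend only on \<open>N\<close>, so that it can hold for many points \<open>b\<close> at once.\<close>

lemma funpow_uniform_relation:
  fixes g :: "'a \<Rightarrow> 'a"
  assumes "(g ^^ i) b = (g ^^ j) b" "i < j" "j \<le> N"
  shows "(g ^^ (N + fact N)) b = (g ^^ N) b"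
proof -
  obtain p where j: "j = i + p"
    using less_imp_add_positive[OF assms(2)] by blast
  have per: "(g ^^ (i + q * p)) b = (g ^^ i) b" for q
  proof (induction q)
    case (Suc q)
    have "(g ^^ (i + Suc q * p)) b = (g ^^ (q * p + j)) b"
      using j by (simp add: add_ac)
    also have "\<dots> = (g ^^ (q * p)) ((g ^^ i) b)"
      using assms(1) by (simp add: funpow_add)
    also have "\<dots> = (g ^^ (i + q * p)) b"
      by (simp add: funpow_funpow add.commute)
    finally show ?case using Suc by simp
  qed simp
  have "p dvd fact N"
    using assms by (intro dvd_fact) (auto simp: j)
  then obtain q where q: "fact N = q * p"
    by (metis dvd_def mult.commute)
  have "(g ^^ (N + fact N)) b = (g ^^ ((N - i) + (i + q * p))) b"
    using assms q by simp
  also have "\<dots> = (g ^^ (N - i)) ((g ^^ i) b)"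
    using per[of q] by (simp only: funpow_add comp_apply)
  also have "\<dots> = (g ^^ ((N - i) + i)) b"
    by (simp only: funpow_add comp_apply)
  finally show ?thesis using assms by simp
qed

text \<open>Put \<open>\<psi> = g\<^sup>d\<close> and \<open>b = g\<^sup>m a\<close>. If one of the first points \<open>\<psi>\<^sup>i b\<close> lies outside \<open>F\<close>, it is
  fixed by \<open>\<psi>\<close>; if all of them lie in \<open>F\<close>, two of them coincide. Either way there is a relation
  with exponents bounded independently of \<open>a\<close>.\<close>

lemma quasi_periodic_on_if_finite_exceptions:
  assumes g: "g \<in> A \<rightarrow> A" and F: "finite F" and d: "d \<ge> 1"
    and exc: "\<And>a. a \<in> A \<Longrightarrow> (g ^^ m) a \<notin> F \<Longrightarrow> (g ^^ (m + d)) a = (g ^^ m) a"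
  shows "quasi_periodic_on A g"
proof -
  define N where "N = Suc (card F)"
  define \<psi> where "\<psi> = g ^^ d"
  have \<psi>: "\<psi> ^^ k = g ^^ (d * k)" for k
    by (simp add: \<psi>_def funpow_mult mult.commute)
  have rel: "(\<psi> ^^ (N + fact N)) ((g ^^ m) a) = (\<psi> ^^ N) ((g ^^ m) a)" if a: "a \<in> A" for a
  proof -
    let ?b = "(g ^^ m) a"
    have pt: "(\<psi> ^^ i) ?b = (g ^^ m) ((g ^^ (d * i)) a)" for i
      by (simp add: \<psi> funpow_funpow add.commute)
    have "\<exists>i j. (\<psi> ^^ i) ?b = (\<psi> ^^ j) ?b \<and> i < j \<and> j \<le> N"
    proof (cases "\<forall>i\<le>card F. (\<psi> ^^ i) ?b \<in> F")
      case True
      then have "(\<lambda>i. (\<psi> ^^ i) ?b) ` {..card F} \<subseteq> F" by auto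
      then have "\<not> inj_on (\<lambda>i. (\<psi> ^^ i) ?b) {..card F}"
        using card_inj_on_le[OF _ _ F] by fastforce
      then obtain i j where "i \<le> card F" "j \<le> card F" "i \<noteq> j" "(\<psi> ^^ i) ?b = (\<psi> ^^ j) ?b"
        unfolding inj_on_def by auto
      then show ?thesis unfolding N_def by (metis le_SucI linorder_neqE_nat)
    next
      case False
      then obtain i where i: "i \<le> card F" "(\<psi> ^^ i) ?b \<notin> F" by blast
      have "(\<psi> ^^ Suc i) ?b = \<psi> ((g ^^ m) ((g ^^ (d * i)) a))" by (simp add: pt)
      also have "\<dots> = (g ^^ (m + d)) ((g ^^ (d * i)) a)"
        by (simp add: \<psi>_def funpow_funpow add_ac)
      also have "\<dots> = (\<psi> ^^ i) ?b"
        using exc[OF funpow_in[OF g a]] i(2) by (simp add: pt)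
      finally show ?thesis
        using i(1) by (intro exI[of _ i] exI[of _ "Suc i"]) (simp add: N_def)
    qed
    then show ?thesis using funpow_uniform_relation by metis
  qed
  show ?thesis
    unfolding quasi_periodic_on_def
  proof (intro exI conjI ballI)
    show "d * N + m < d * (N + fact N) + m" "1 \<le> d * N + m"
      using d by (simp_all add: N_def add_mult_distrib2)
    show "(g ^^ (d * (N + fact N) + m)) a = (g ^^ (d * N + m)) a" if "a \<in> A" for a
      using rel[OF that] by (simp only: \<psi> funpow_add comp_apply)
  qed
qed

lemma funpow_gen_shift:
  assumes "\<phi> \<in> \<Gamma> \<rightarrow> \<Gamma>" "x \<in> extensional \<Gamma>"
  shows "(gen_shift \<Gamma> \<phi> ^^ k) x = (\<lambda>\<alpha>\<in>\<Gamma>. x ((\<phi> ^^ k) \<alpha>))"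
proof (induction k)
  case 0
  show ?case using assms(2) by (simp add: extensional_restrict)
next
  case (Suc k)
  have "\<phi> \<alpha> \<in> \<Gamma>" if "\<alpha> \<in> \<Gamma>" for \<alpha> using assms(1) that by auto
  then have "gen_shift \<Gamma> \<phi> (\<lambda>\<alpha>\<in>\<Gamma>. x ((\<phi> ^^ k) \<alpha>)) = (\<lambda>\<alpha>\<in>\<Gamma>. x ((\<phi> ^^ Suc k) \<alpha>))"
    by (auto simp: gen_shift_def funpow_swap1)
  then show ?case by (simp only: Suc funpow.simps comp_apply)
qed

section \<open>Two computations of entropy\<close>

lemma ent_set_at_eq_0:
  assumes D: "finite D" and "m < n" and eq: "\<And>x. x \<in> D \<Longrightarrow> (g ^^ n) x = (g ^^ m) x"
  shows "ent_set_at g D = 0"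
proof -
  define T where "T = (\<Union>k<n. (g ^^ k) ` D)"
  have "(g ^^ k) x \<in> T" if x: "x \<in> D" for k x
  proof (induction k rule: less_induct)
    case (less k)
    show ?case
    proof (cases "k < n")
      case True
      then show ?thesis using x by (auto simp: T_def)
    next
      case False
      then have "(g ^^ k) x = (g ^^ (k - n)) ((g ^^ n) x)"
        by (simp add: funpow_funpow)
      also have "\<dots> = (g ^^ (k - n + m)) x" by (simp add: eq[OF x] funpow_funpow)
      finally show ?thesis using less[of "k - n + m"] False \<open>m < n\<close> by simp
    qed
  qed
  then have "card (\<Union>k<i. (g ^^ k) ` D) \<le> card T" for i
    using D by (intro card_mono) (auto simp: T_def)
  then have "(\<lambda>i. real (card (\<Union>k<i. (g ^^ k) ` D)) / real i) \<longlonglongrightarrow> 0"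
    by (intro tendsto_sandwich[OF _ _ tendsto_const lim_const_over_n[of "real (card T)"]])
      (auto intro!: always_eventually divide_right_mono)
  then show ?thesis using LIMSEQ_ent_set_at[OF D] LIMSEQ_unique by blast
qed

lemma ent_set_at_disjoint_orbits:
  fixes x :: "nat \<Rightarrow> 'a"
  assumes inj: "inj (\<lambda>(j, n). (g ^^ n) (x j))"
  shows "ent_set_at g (x ` {..<K}) = real K"
proof -
  have "card (\<Union>k<n. (g ^^ k) ` x ` {..<K}) = K * n" for n
  proof -
    have "(\<Union>k<n. (g ^^ k) ` x ` {..<K}) = (\<lambda>(j, n). (g ^^ n) (x j)) ` ({..<K} \<times> {..<n})"
      by force
    then show ?thesis
      using card_image[OF inj_on_subset[OF inj subset_UNIV]] by simp
  qed
  then have "\<forall>\<^sub>F n in sequentially. real K = real (card (\<Union>k<n. (g ^^ k) ` x ` {..<K})) / real n"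
    by (intro eventually_sequentiallyI[of 1]) simp
  then have "(\<lambda>n. real (card (\<Union>k<n. (g ^^ k) ` x ` {..<K})) / real n) \<longlonglongrightarrow> real K"
    by (rule Lim_transform_eventually[OF tendsto_const])
  then show ?thesis
    using LIMSEQ_ent_set_at[of "x ` {..<K}" g] LIMSEQ_unique by blast
qed

section \<open>Generic colourings\<close>

text \<open>A Baire category argument in the space of \<open>2\<close>-colourings, made explicit: the \<open>t\<close>-th stage
  fixes the colours on a finite set so that the \<open>t\<close>-th requirement is met by two points of it,
  which no later stage can undo.\<close>

lemma exists_separating_colouring:
  fixes P :: "'k \<Rightarrow> ('c \<times> 'c) set"
  assumes I: "countable I"
    and fresh: "\<And>i F. i \<in> I \<Longrightarrow> finite F \<Longrightarrow> \<exists>u v. (u, v) \<in> P i \<and> u \<notin> F \<and> u \<noteq> v"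
  shows "\<exists>h :: 'c \<Rightarrow> bool. \<forall>i\<in>I. \<exists>u v. (u, v) \<in> P i \<and> h u \<noteq> h v"
proof (cases "I = {}")
  case False
  define Q where "Q t = P (from_nat_into I t)" for t
  define ext where "ext t S S' \<longleftrightarrow> fst S \<subseteq> fst S' \<and> (\<forall>c\<in>fst S. snd S' c = snd S c)
      \<and> (\<exists>u v. (u, v) \<in> Q t \<and> u \<in> fst S' \<and> v \<in> fst S' \<and> snd S' u \<noteq> snd S' v)"
    for t and S S' :: "'c set \<times> ('c \<Rightarrow> bool)"
  have "\<exists>S. \<forall>t. finite (fst (S t)) \<and> ext t (S t) (S (Suc t))"
  proof (rule dependent_nat_choice)
    have "finite (fst ({} :: 'c set, undefined :: 'c \<Rightarrow> bool))" by simp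
    then show "\<exists>S :: 'c set \<times> ('c \<Rightarrow> bool). finite (fst S)" ..
  next
    fix S :: "'c set \<times> ('c \<Rightarrow> bool)" and t
    assume fin: "finite (fst S)"
    obtain u v where uv: "(u, v) \<in> Q t" "u \<notin> fst S" "u \<noteq> v"
      using fresh[OF from_nat_into[OF False] fin] unfolding Q_def by blast
    define S' where "S' = (insert u (insert v (fst S)), (snd S)(u := \<not> snd S v))"
    have "ext t S S'"
      unfolding ext_def
    proof (intro conjI exI)
      show "(u, v) \<in> Q t" by (rule uv(1))
      show "fst S \<subseteq> fst S'" "u \<in> fst S'" "v \<in> fst S'" by (auto simp: S'_def)
      show "\<forall>c\<in>fst S. snd S' c = snd S c" using uv(2) by (auto simp: S'_def)
      show "snd S' u \<noteq> snd S' v" using uv(3) by (simp add: S'_def)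
    qed
    moreover have "finite (fst S')" using fin by (simp add: S'_def)
    ultimately show "\<exists>S'. finite (fst S') \<and> ext t S S'" by blast
  qed
  then obtain S where S: "\<And>t. ext t (S t) (S (Suc t))" by blast
  define F H where "F t = fst (S t)" and "H t = snd (S t)" for t
  have stable: "c \<in> F (t + k) \<and> H (t + k) c = H t c" if "c \<in> F t" for c t k
    using that S by (induction k) (auto simp: ext_def F_def H_def)
  define h where "h c \<longleftrightarrow> (\<exists>t. c \<in> F t \<and> H t c)" for c
  have h: "h c = H t c" if "c \<in> F t" for c t
  proof -
    have "H s c = H t c" if "c \<in> F s" for s
      using stable[OF that, of t] stable[OF \<open>c \<in> F t\<close>, of s] by (simp add: add.commute)
    then show ?thesis using that unfolding h_def by blast
  qed
  show ?thesis
  proof (intro exI[of _ h] ballI)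
    fix i assume "i \<in> I"
    then obtain t where "P i = Q t"
      using I unfolding Q_def by (metis from_nat_into_surj)
    moreover obtain u v where "(u, v) \<in> Q t" "u \<in> F (Suc t)" "v \<in> F (Suc t)"
        "H (Suc t) u \<noteq> H (Suc t) v"
      using S[of t] by (auto simp: ext_def F_def H_def)
    ultimately show "\<exists>u v. (u, v) \<in> P i \<and> h u \<noteq> h v" using h by metis
  qed
qed simp

text \<open>It suffices to treat \<open>m \<le> n\<close>. The point to be coloured freshly is then \<open>(l, \<phi>\<^sup>m a)\<close>, with the
  smaller exponent, since it is \<open>\<phi>\<^sup>m a\<close> that can be chosen outside any finite set.\<close>

lemma exists_disjoint_infinite_orbits:
  fixes X :: "'x set" and \<Gamma> :: "'i set"
  assumes pq: "p \<in> X" "q \<in> X" "p \<noteq> q" and \<phi>: "\<phi> \<in> \<Gamma> \<rightarrow> \<Gamma>"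
    and nqp: "\<not> quasi_periodic_on \<Gamma> \<phi>"
  shows "\<exists>x :: nat \<Rightarrow> 'i \<Rightarrow> 'x. range x \<subseteq> (\<Gamma> \<rightarrow>\<^sub>E X) \<and> inj (\<lambda>(j, n). (gen_shift \<Gamma> \<phi> ^^ n) (x j))"
proof -
  define I :: "(nat \<times> nat \<times> nat \<times> nat) set"
    where "I = {(l, m, j, n). m \<le> n \<and> (l, m) \<noteq> (j, n)}"
  define P :: "nat \<times> nat \<times> nat \<times> nat \<Rightarrow> ((nat \<times> 'i) \<times> (nat \<times> 'i)) set"
    where "P = (\<lambda>(l, m, j, n). (\<lambda>a. ((l, (\<phi> ^^ m) a), (j, (\<phi> ^^ n) a))) ` \<Gamma>)"
  have fresh: "\<exists>u v. (u, v) \<in> P i \<and> u \<notin> F \<and> u \<noteq> v" if "i \<in> I" "finite F" for i and F :: "(nat \<times> 'i) set"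
  proof -
    obtain l m j n where i: "i = (l, m, j, n)" "m \<le> n" "(l, m) \<noteq> (j, n)"
      using \<open>i \<in> I\<close> by (auto simp: I_def)
    \<comment> \<open>For \<open>m = n\<close> the two points already differ in \<open>l \<noteq> j\<close>, and only \<open>\<phi>\<^sup>m a \<notin> snd ` F\<close> matters;
      \<open>d = 1\<close> is then an arbitrary choice.\<close>
    define d where "d = (if m = n then 1 else n - m)"
    have "d \<ge> 1" using i(2) by (auto simp: d_def)
    then obtain a where a: "a \<in> \<Gamma>" "(\<phi> ^^ m) a \<notin> snd ` F" "(\<phi> ^^ (m + d)) a \<noteq> (\<phi> ^^ m) a"
      using quasi_periodic_on_if_finite_exceptions[OF \<phi>, of "snd ` F" d m] nqp \<open>finite F\<close> by blast
    have "(l, (\<phi> ^^ m) a) \<noteq> (j, (\<phi> ^^ n) a)"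
      using a(3) i by (auto simp: d_def split: if_splits)
    moreover have "(l, (\<phi> ^^ m) a) \<notin> F" using a(2) by force
    moreover have "((l, (\<phi> ^^ m) a), (j, (\<phi> ^^ n) a)) \<in> P i"
      using a(1) by (auto simp: i(1) P_def)
    ultimately show ?thesis by blast
  qed
  have "\<exists>h :: nat \<times> 'i \<Rightarrow> bool. \<forall>i\<in>I. \<exists>u v. (u, v) \<in> P i \<and> h u \<noteq> h v"
    by (rule exists_separating_colouring) (use fresh in auto)
  then obtain h :: "nat \<times> 'i \<Rightarrow> bool"
    where h: "\<forall>i\<in>I. \<exists>u v. (u, v) \<in> P i \<and> h u \<noteq> h v"
    by blast
  define x where "x j = (\<lambda>\<alpha>\<in>\<Gamma>. if h (j, \<alpha>) then p else q)" for j
  let ?\<sigma> = "gen_shift \<Gamma> \<phi>"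
  have range: "range x \<subseteq> (\<Gamma> \<rightarrow>\<^sub>E X)" using pq by (auto simp: x_def)
  have iter: "(?\<sigma> ^^ n) (x j) a = (if h (j, (\<phi> ^^ n) a) then p else q)" if "a \<in> \<Gamma>" for n j a
    using that funpow_in[OF \<phi> that] by (simp add: funpow_gen_shift[OF \<phi>] x_def)
  have neq: "(?\<sigma> ^^ m) (x l) \<noteq> (?\<sigma> ^^ n) (x j)" if "m \<le> n" "(l, m) \<noteq> (j, n)" for l m j n
  proof -
    have "(l, m, j, n) \<in> I" using that by (simp add: I_def)
    with h obtain a where a: "a \<in> \<Gamma>" "h (l, (\<phi> ^^ m) a) \<noteq> h (j, (\<phi> ^^ n) a)"
      by (force simp: P_def)
    then have "(?\<sigma> ^^ m) (x l) a \<noteq> (?\<sigma> ^^ n) (x j) a" using pq(3) by (auto simp: iter)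
    then show ?thesis by metis
  qed
  have "inj (\<lambda>(j, n). (?\<sigma> ^^ n) (x j))"
  proof (rule injI, clarify)
    fix l m j n assume "(?\<sigma> ^^ m) (x l) = (?\<sigma> ^^ n) (x j)"
    then show "l = j \<and> m = n" using neq[of m n l j] neq[of n m j l] by (metis nat_le_linear prod.inject)
  qed
  with range show ?thesis by blast
qed

section \<open>The entropy of generalized shifts\<close>

theorem corollary2p5:
  fixes X :: "'x set" and \<Gamma> :: "'i set" and \<phi> :: "'i \<Rightarrow> 'i"
  assumes "\<exists>x\<in>X. \<exists>y\<in>X. x \<noteq> y"
    and "\<Gamma> \<noteq> {}"
    and "\<phi> \<in> \<Gamma> \<rightarrow> \<Gamma>"
  shows "ent_set (\<Gamma> \<rightarrow>\<^sub>E X) (gen_shift \<Gamma> \<phi>) =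
    (if quasi_periodic_on \<Gamma> \<phi> then 0 else \<infinity>)"
proof (cases "quasi_periodic_on \<Gamma> \<phi>")
  case True
  then obtain n m where nm: "m < n" "\<forall>a\<in>\<Gamma>. (\<phi> ^^ n) a = (\<phi> ^^ m) a"
    unfolding quasi_periodic_on_def by blast
  have "(gen_shift \<Gamma> \<phi> ^^ n) x = (gen_shift \<Gamma> \<phi> ^^ m) x" if "x \<in> \<Gamma> \<rightarrow>\<^sub>E X" for x
    using that nm(2) by (auto simp: PiE_iff funpow_gen_shift[OF assms(3)])
  then have "ent_set_at (gen_shift \<Gamma> \<phi>) D = 0" if "finite D \<and> D \<subseteq> (\<Gamma> \<rightarrow>\<^sub>E X)" for D
    using that by (intro ent_set_at_eq_0[OF _ nm(1)]) auto
  then have "ent_set (\<Gamma> \<rightarrow>\<^sub>E X) (gen_shift \<Gamma> \<phi>)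
      = (SUP D\<in>{D. finite D \<and> D \<subseteq> (\<Gamma> \<rightarrow>\<^sub>E X)}. 0)"
    unfolding ent_set_def by (intro SUP_cong) (auto simp: zero_ereal_def)
  also have "\<dots> = 0" by (rule cSUP_const) blast
  finally show ?thesis using True by simp
next
  case False
  then obtain x :: "nat \<Rightarrow> 'i \<Rightarrow> 'x" where x: "range x \<subseteq> (\<Gamma> \<rightarrow>\<^sub>E X)"
      "inj (\<lambda>(j, n). (gen_shift \<Gamma> \<phi> ^^ n) (x j))"
    using exists_disjoint_infinite_orbits assms(1,3) by metis
  have "ereal (real K) \<le> ent_set (\<Gamma> \<rightarrow>\<^sub>E X) (gen_shift \<Gamma> \<phi>)" for K
  proof -
    have "ereal (ent_set_at (gen_shift \<Gamma> \<phi>) (x ` {..<K})) \<le> ent_set (\<Gamma> \<rightarrow>\<^sub>E X) (gen_shift \<Gamma> \<phi>)"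
      unfolding ent_set_def using x(1) by (intro SUP_upper) auto
    then show ?thesis by (simp only: ent_set_at_disjoint_orbits[OF x(2)])
  qed
  then have "ent_set (\<Gamma> \<rightarrow>\<^sub>E X) (gen_shift \<Gamma> \<phi>) = \<infinity>"
    by (intro ereal_top) (meson ereal_less_eq(3) order_trans real_arch_simple)
  then show ?thesis using False by simp
qed

end
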